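(* Let $(\gamma_t,f_1,f_2):I\to AdS^3\times\Delta_5$ be a pseudo-spherical timelike framed immersion with curvature $(\alpha,\hat\ell,0,\hat n)$, with $\hat n^2>\alpha^2$ and $f\neq0$ on $I$. Put $\zeta=(\hat n\gamma_t-\alpha f_2)/\sqrt{\hat n^2-\alpha^2}$ (a unit timelike vector) and let $$\mathcal{F}_3:I\times\mathbb{R}\to AdS^3,\qquad \mathcal{F}_3(s,\theta)=\cosh\theta\,\zeta(s)+\sinh\theta\,f_1(s)$$ be the focal surface of $\gamma_t$. Then the set of singular points of $\mathcal{F}_3$ coincides with the AdS-evolute of $\gamma_t$ (up to the sign $\pm$ in the definition of the evolute), in the following sense: $(s_0,\theta_0)$ is a singular point of $\mathcal{F}_3$ if and only if $f(s_0)<0$ and $\mathcal{F}_3(s_0,\theta_0)\in\{\mathcal{E}_a(\gamma_t)(s_0),-\mathcal{E}_a(\gamma_t)(s_0)\}$; and for every $s_0\in I$ with $f(s_0)<0$ there is such a $\theta_0$.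
   Context: $\mathbb{R}^4_2$ is $\mathbb{R}^4$ with $\langle u,w\rangle=-u_1w_1-u_2w_2+u_3w_3+u_4w_4$; the triple product $u\times v\times w$ is the unique vector with $\langle x,u\times v\times w\rangle=\det(x,u,v,w)$ for all $x$. $AdS^3=\{u:\langle u,u\rangle=-1\}$, $S^3_2=\{u:\langle u,u\rangle=1\}$, $\Delta_5=\{(u,w)\in S^3_2\times S^3_2:\langle u,w\rangle=0\}$. A pseudo-spherical timelike framed immersion $(\gamma_t,f_1,f_2):I\to AdS^3\times\Delta_5$ is a smooth immersion with $\langle\gamma_t,f_i\rangle=\langle\gamma_t',f_i\rangle=0$, $i=1,2$. Here it has curvature $(\alpha,\hat\ell,0,\hat n)$, meaning that with $\mu=\gamma_t\times f_1\times f_2$ (unit timelike), $$\gamma_t'=\alpha\mu,\quad f_1'=\hat\ell f_2,\quad f_2'=-\hat\ell f_1+\hat n\mu,\quad \mu'=-\alpha\gamma_t+\hat nf_2 .$$ Put $f=(\alpha\hat n'-\hat n\alpha')^2-\hat\ell^2\hat n^2(\hat n^2-\alpha^2)$. Where $f<0$, the AdS-evolute is $$\mathcal{E}_a(\gamma_t)=\pm\frac{\hat\ell\hat n(\hat n\gamma_t-\alpha f_2)-(\alpha\hat n'-\hat n\alpha')f_1}{\sqrt{-f}}\in AdS^3 .$$ A point $(s_0,\theta_0)$ is singular for $\mathcal{F}_3$ if $\partial\mathcal{F}_3/\partial s$ and $\partial\mathcal{F}_3/\partial\theta$ are linearly dependent there, equivalently $\mathcal{F}_3\times\frac{\partial\mathcal{F}_3}{\partial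 s}\times\frac{\partial\mathcal{F}_3}{\partial\theta}=0$ at $(s_0,\theta_0)$. *)

theory Defs
  imports "HOL-Analysis.Analysis"
begin

section \<open>The pseudo-Euclidean space of signature (-,-,+,+)\<close>

definition pip :: "real^4 \<Rightarrow> real^4 \<Rightarrow> real" where
  "pip u w = - u$1 * w$1 - u$2 * w$2 + u$3 * w$3 + u$4 * w$4"

definition triple_prod :: "real^4 \<Rightarrow> real^4 \<Rightarrow> real^4 \<Rightarrow> real^4" where
  "triple_prod u v w = (THE z. \<forall>x. pip x z = det (vector [x, u, v, w] :: real^4^4))"

definition AdS3 :: "(real^4) set" where
  "AdS3 = {u. pip u u = -1}"

definition S32 :: "(real^4) set" where
  "S32 = {u. pip u u = 1}"

definition Delta5 :: "((real^4) \<times> (real^4)) set" where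
  "Delta5 = {(u, w). u \<in> S32 \<and> w \<in> S32 \<and> pip u w = 0}"

text \<open>The description of the triple product does determine a unique vector.\<close>

lemma vector_4_nth:
  "(vector [a, b, c, d] :: 'a::zero^4) $ 1 = a"
  "(vector [a, b, c, d] :: 'a::zero^4) $ 2 = b"
  "(vector [a, b, c, d] :: 'a::zero^4) $ 3 = c"
  "(vector [a, b, c, d] :: 'a::zero^4) $ 4 = d"
  unfolding vector_def by simp_all

lemma linear_det_first_row: "linear (\<lambda>x. det (vector [x, u, v, w] :: real^4^4))"
proof -
  define M :: "real^4^4" where "M = vector [0, u, v, w]"
  have eq: "(vector [x, u, v, w] :: real^4^4) = (\<chi> i. if i = 1 then x else M $ i)" for x
    by (simp add: M_def vec_eq_iff forall_4 vector_4_nth)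
  show ?thesis
    unfolding eq
    by (intro linearI)
      (simp_all add: det_row_add det_row_mul[where k = 1, symmetric] scalar_mult_eq_scaleR cong: if_cong)
qed

lemma triple_prod_ex1: "\<exists>!z. \<forall>x. pip x z = det (vector [x, u, v, w] :: real^4^4)"
proof -
  define h where "h = (\<lambda>x. det (vector [x, u, v, w] :: real^4^4))"
  have lin: "linear h"
    unfolding h_def by (rule linear_det_first_row)
  have h: "h x = x$1 * h (axis 1 1) + x$2 * h (axis 2 1) + x$3 * h (axis 3 1) + x$4 * h (axis 4 1)" for x
  proof -
    have "x = (\<Sum>i\<in>UNIV. (x$i) *\<^sub>R axis i 1)"
      by (simp add: basis_expansion flip: scalar_mult_eq_scaleR)
    then have "h x = h (\<Sum>i\<in>UNIV. (x$i) *\<^sub>R axis i 1)"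
      by simp
    also have "\<dots> = (\<Sum>i\<in>UNIV. (x$i) * h (axis i 1))"
      by (simp add: linear_sum[OF lin] linear_cmul[OF lin])
    finally show ?thesis
      by (simp add: sum_4)
  qed
  define z :: "real^4" where "z = vector [- h (axis 1 1), - h (axis 2 1), h (axis 3 1), h (axis 4 1)]"
  have "\<forall>x. pip x z = h x"
    by (subst h) (simp add: z_def pip_def vector_4_nth)
  moreover have "z' = z" if z': "\<forall>x. pip x z' = h x" for z'
  proof -
    have "pip (axis i 1) z' = pip (axis i 1) z" for i
      using z' \<open>\<forall>x. pip x z = h x\<close> by simp
    from this[of 1] this[of 2] this[of 3] this[of 4] show ?thesis
      by (simp add: pip_def axis_def vec_eq_iff forall_4)
  qed
  ultimately show ?thesis
    unfolding h_def by blast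
qed

lemma pip_triple_prod: "pip x (triple_prod u v w) = det (vector [x, u, v, w] :: real^4^4)"
  using theI'[OF triple_prod_ex1] unfolding triple_prod_def by blast


section \<open>Timelike framed immersions\<close>

text \<open>All derivatives are taken within the parameter interval; at interior points, and hence
  everywhere on an open interval, they are the ordinary ones, and at an end point contained in
  the interval they are one-sided.\<close>

definition smooth_within :: "real set \<Rightarrow> (real \<Rightarrow> 'a::real_normed_vector) \<Rightarrow> bool" where
  "smooth_within I g \<longleftrightarrow>
    (\<exists>D :: nat \<Rightarrow> real \<Rightarrow> 'a. (\<forall>s\<in>I. D 0 s = g s) \<and>
      (\<forall>k. \<forall>s\<in>I. (D k has_vector_derivative D (Suc k) s) (at s within I)))"

definition timelike_framed_immersion ::
    "real set \<Rightarrow> (real \<Rightarrow> real^4) \<Rightarrow> (real \<Rightarrow> real^4) \<Rightarrow> (real \<Rightarrow> real^4) \<Rightarrow> bool" where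
  "timelike_framed_immersion I \<gamma> f1 f2 \<longleftrightarrow>
    smooth_within I (\<lambda>s. (\<gamma> s, f1 s, f2 s)) \<and>
    (\<forall>s\<in>I. (\<gamma> s, (f1 s, f2 s)) \<in> AdS3 \<times> Delta5 \<and>
      vector_derivative (\<lambda>s. (\<gamma> s, f1 s, f2 s)) (at s within I) \<noteq> 0 \<and>
      pip (\<gamma> s) (f1 s) = 0 \<and> pip (\<gamma> s) (f2 s) = 0 \<and>
      pip (vector_derivative \<gamma> (at s within I)) (f1 s) = 0 \<and>
      pip (vector_derivative \<gamma> (at s within I)) (f2 s) = 0)"

definition frame_mu ::
    "(real \<Rightarrow> real^4) \<Rightarrow> (real \<Rightarrow> real^4) \<Rightarrow> (real \<Rightarrow> real^4) \<Rightarrow> real \<Rightarrow> real^4" where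
  "frame_mu \<gamma> f1 f2 s = triple_prod (\<gamma> s) (f1 s) (f2 s)"

definition has_curvature ::
    "real set \<Rightarrow> (real \<Rightarrow> real^4) \<Rightarrow> (real \<Rightarrow> real^4) \<Rightarrow> (real \<Rightarrow> real^4) \<Rightarrow>
      (real \<Rightarrow> real) \<times> (real \<Rightarrow> real) \<times> (real \<Rightarrow> real) \<times> (real \<Rightarrow> real) \<Rightarrow> bool" where
  "has_curvature I \<gamma> f1 f2 = (\<lambda>(\<alpha>, l, m, n). \<forall>s\<in>I. let \<mu> = frame_mu \<gamma> f1 f2 in
    (\<gamma> has_vector_derivative \<alpha> s *\<^sub>R \<mu> s) (at s within I) \<and>
    (f1 has_vector_derivative l s *\<^sub>R f2 s + m s *\<^sub>R \<mu> s) (at s within I) \<and>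
    (f2 has_vector_derivative - l s *\<^sub>R f1 s + n s *\<^sub>R \<mu> s) (at s within I) \<and>
    (\<mu> has_vector_derivative - \<alpha> s *\<^sub>R \<gamma> s + m s *\<^sub>R f1 s + n s *\<^sub>R f2 s) (at s within I))"


section \<open>Evolute and focal surface\<close>

definition wronskian :: "real set \<Rightarrow> (real \<Rightarrow> real) \<Rightarrow> (real \<Rightarrow> real) \<Rightarrow> real \<Rightarrow> real" where
  "wronskian I \<alpha> n s =
    \<alpha> s * vector_derivative n (at s within I) - n s * vector_derivative \<alpha> (at s within I)"

definition evolute_disc ::
    "real set \<Rightarrow> (real \<Rightarrow> real) \<Rightarrow> (real \<Rightarrow> real) \<Rightarrow> (real \<Rightarrow> real) \<Rightarrow> real \<Rightarrow> real" where
  "evolute_disc I \<alpha> l n s =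
    (wronskian I \<alpha> n s)\<^sup>2 - (l s)\<^sup>2 * (n s)\<^sup>2 * ((n s)\<^sup>2 - (\<alpha> s)\<^sup>2)"

text \<open>The evolute with the plus sign; it is meaningful only where \<open>evolute_disc\<close> is negative.\<close>

definition AdS_evolute ::
    "real set \<Rightarrow> (real \<Rightarrow> real^4) \<Rightarrow> (real \<Rightarrow> real^4) \<Rightarrow> (real \<Rightarrow> real^4) \<Rightarrow>
      (real \<Rightarrow> real) \<Rightarrow> (real \<Rightarrow> real) \<Rightarrow> (real \<Rightarrow> real) \<Rightarrow> real \<Rightarrow> real^4" where
  "AdS_evolute I \<gamma> f1 f2 \<alpha> l n s =
    (1 / sqrt (- evolute_disc I \<alpha> l n s)) *\<^sub>R
      ((l s * n s) *\<^sub>R (n s *\<^sub>R \<gamma> s - \<alpha> s *\<^sub>R f2 s) - wronskian I \<alpha> n s *\<^sub>R f1 s)"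

definition focal_zeta ::
    "(real \<Rightarrow> real^4) \<Rightarrow> (real \<Rightarrow> real^4) \<Rightarrow> (real \<Rightarrow> real) \<Rightarrow> (real \<Rightarrow> real) \<Rightarrow> real \<Rightarrow> real^4" where
  "focal_zeta \<gamma> f2 \<alpha> n s =
    (1 / sqrt ((n s)\<^sup>2 - (\<alpha> s)\<^sup>2)) *\<^sub>R (n s *\<^sub>R \<gamma> s - \<alpha> s *\<^sub>R f2 s)"

definition focal_surface ::
    "(real \<Rightarrow> real^4) \<Rightarrow> (real \<Rightarrow> real^4) \<Rightarrow> (real \<Rightarrow> real^4) \<Rightarrow> (real \<Rightarrow> real) \<Rightarrow> (real \<Rightarrow> real) \<Rightarrow>
      real \<times> real \<Rightarrow> real^4" where
  "focal_surface \<gamma> f1 f2 \<alpha> n =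
    (\<lambda>(s, \<theta>). cosh \<theta> *\<^sub>R focal_zeta \<gamma> f2 \<alpha> n s + sinh \<theta> *\<^sub>R f1 s)"

text \<open>Linear dependence is that of the pair of partial derivatives, so two equal vectors count as
  dependent; this is why it is not expressed by \<open>dependent\<close> on a two-element set.\<close>

definition singular_point :: "real set \<Rightarrow> (real \<times> real \<Rightarrow> real^4) \<Rightarrow> real \<times> real \<Rightarrow> bool" where
  "singular_point I F = (\<lambda>(s\<^sub>0, \<theta>\<^sub>0). \<exists>a b :: real. (a \<noteq> 0 \<or> b \<noteq> 0) \<and>
    a *\<^sub>R vector_derivative (\<lambda>s. F (s, \<theta>\<^sub>0)) (at s\<^sub>0 within I) +
    b *\<^sub>R vector_derivative (\<lambda>\<theta>. F (s\<^sub>0, \<theta>)) (at \<theta>\<^sub>0) = 0)"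

lemma pip_simps:
  "pip (x + y) z = pip x z + pip y z" "pip z (x + y) = pip z x + pip z y"
  "pip (x - y) z = pip x z - pip y z" "pip z (x - y) = pip z x - pip z y"
  "pip (c *\<^sub>R x) z = c * pip x z" "pip z (c *\<^sub>R x) = c * pip z x"
  by (simp_all add: pip_def algebra_simps)

lemma pip_commute: "pip x y = pip y x"
  by (simp add: pip_def)

lemma focal_zeta_timelike:
  assumes "timelike_framed_immersion I \<gamma> f1 f2" "s \<in> I" "(n s)\<^sup>2 > (\<alpha> s)\<^sup>2"
  shows "pip (focal_zeta \<gamma> f2 \<alpha> n s) (focal_zeta \<gamma> f2 \<alpha> n s) = -1"
proof -
  have *: "pip (\<gamma> s) (\<gamma> s) = -1" "pip (f2 s) (f2 s) = 1" "pip (\<gamma> s) (f2 s) = 0" "pip (f2 s) (\<gamma> s) = 0"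
    using assms by (auto simp: timelike_framed_immersion_def AdS3_def Delta5_def S32_def pip_commute)
  have "pip (n s *\<^sub>R \<gamma> s - \<alpha> s *\<^sub>R f2 s) (n s *\<^sub>R \<gamma> s - \<alpha> s *\<^sub>R f2 s) = - ((n s)\<^sup>2 - (\<alpha> s)\<^sup>2)"
    by (simp add: pip_simps * power2_eq_square)
  moreover have "(1 / sqrt ((n s)\<^sup>2 - (\<alpha> s)\<^sup>2)) * (1 / sqrt ((n s)\<^sup>2 - (\<alpha> s)\<^sup>2)) = 1 / ((n s)\<^sup>2 - (\<alpha> s)\<^sup>2)"
    using assms(3) by simp
  ultimately show ?thesis
    using assms(3) unfolding focal_zeta_def pip_simps(5,6) mult.assoc[symmetric] by (simp add: field_simps)
qed

lemma focal_surface_in_AdS3: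
  assumes "timelike_framed_immersion I \<gamma> f1 f2" "s \<in> I" "(n s)\<^sup>2 > (\<alpha> s)\<^sup>2"
  shows "focal_surface \<gamma> f1 f2 \<alpha> n (s, \<theta>) \<in> AdS3"
proof -
  have *: "pip (f1 s) (f1 s) = 1" "pip (\<gamma> s) (f1 s) = 0" "pip (f2 s) (f1 s) = 0"
    using assms by (auto simp: timelike_framed_immersion_def Delta5_def S32_def pip_commute)
  have z: "pip (focal_zeta \<gamma> f2 \<alpha> n s) (f1 s) = 0"
    by (simp add: focal_zeta_def pip_simps *)
  then have z': "pip (f1 s) (focal_zeta \<gamma> f2 \<alpha> n s) = 0"
    by (simp add: pip_commute)
  show ?thesis
    using cosh_square_eq[of \<theta>] focal_zeta_timelike[of I \<gamma> f1 f2 s \<alpha> n, OF assms]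
    by (simp add: focal_surface_def AdS3_def pip_simps z z' * power2_eq_square)
qed

lemma AdS_evolute_in_AdS3:
  assumes "timelike_framed_immersion I \<gamma> f1 f2" "s \<in> I" "evolute_disc I \<alpha> l n s < 0"
  shows "AdS_evolute I \<gamma> f1 f2 \<alpha> l n s \<in> AdS3"
proof -
  define W where "W = wronskian I \<alpha> n s"
  define d where "d = - evolute_disc I \<alpha> l n s"
  have d: "d > 0" "d = (l s)\<^sup>2 * (n s)\<^sup>2 * ((n s)\<^sup>2 - (\<alpha> s)\<^sup>2) - W\<^sup>2"
    using assms(3) by (simp_all add: d_def W_def evolute_disc_def)
  have *: "pip (\<gamma> s) (\<gamma> s) = -1" "pip (f1 s) (f1 s) = 1" "pip (f2 s) (f2 s) = 1"
    "pip (\<gamma> s) (f1 s) = 0" "pip (f1 s) (\<gamma> s) = 0" "pip (\<gamma> s) (f2 s) = 0"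
    "pip (f2 s) (\<gamma> s) = 0" "pip (f1 s) (f2 s) = 0" "pip (f2 s) (f1 s) = 0"
    using assms
    by (auto simp: timelike_framed_immersion_def AdS3_def Delta5_def S32_def pip_commute)
  define v where "v = (l s * n s) *\<^sub>R (n s *\<^sub>R \<gamma> s - \<alpha> s *\<^sub>R f2 s) - W *\<^sub>R f1 s"
  have "pip v v = - d"
    by (simp add: v_def pip_simps * d(2) power2_eq_square algebra_simps)
  moreover have "AdS_evolute I \<gamma> f1 f2 \<alpha> l n s = (1 / sqrt d) *\<^sub>R v"
    by (simp add: AdS_evolute_def v_def W_def d_def)
  ultimately show ?thesis
    using d(1) by (simp add: AdS3_def pip_simps)
qed

end

theory Submission
  imports Defs
begin

text \<open>Write \<open>D = n\<^sup>2 - \<alpha>\<^sup>2\<close>, \<open>W = \<alpha> n' - n \<alpha>'\<close> and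
  \<open>\<eta> = (n f\<^sub>2 - \<alpha> \<gamma>) / sqrt D\<close>, so that \<open>\<zeta>\<close>, \<open>\<eta>\<close>, \<open>f\<^sub>1\<close> are pairwise orthogonal.  A computation
  with the Frenet type equations gives
  \<open>F\<^sub>s = ((W cosh \<theta> + l n sqrt D sinh \<theta>) / D) \<eta> + (\<alpha> l / sqrt D) F\<^sub>\<theta>\<close>, and \<open>F\<^sub>\<theta>\<close> is a nonzero vector
  orthogonal to \<open>\<eta>\<close>.  Hence the singular points are the solutions of
  \<open>W cosh \<theta> + l n sqrt D sinh \<theta> = 0\<close>, that is, the points at which \<open>(cosh \<theta>, sinh \<theta>)\<close> is a
  normalisation of \<open>\<plusminus>(l n sqrt D, - W)\<close>; the latter vector has the pseudo-norm \<open>- f\<close>.\<close>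

section \<open>Calculus for the pseudo-scalar product\<close>

text \<open>Supplies the product rule for \<open>pip\<close>; boundedness is automatic in finite
  dimension.\<close>

lemma bounded_bilinear_pip: "bounded_bilinear pip"
  unfolding bilinear_conv_bounded_bilinear[symmetric] bilinear_def
  by (auto intro!: linearI simp: pip_simps)

text \<open>A connected set that is not a singleton has no isolated points. This makes derivatives
  within \<open>I\<close> unique, end points included.\<close>

lemma at_within_interval_neq_bot:
  fixes I :: "real set"
  assumes "is_interval I" "interior I \<noteq> {}" "s \<in> I"
  shows "at s within I \<noteq> bot"
proof -
  have "I \<noteq> {x}" for x
    using assms(2) by auto
  moreover have "connected I"
    using assms(1) by (simp add: is_interval_connected)
  ultimately have "s islimpt I"
    using assms(3) connected_imp_perfect by metis
  then show ?thesis
    by (simp add: trivial_limit_within)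
qed

text \<open>Only the first two orders of smoothness are extracted, enough to differentiate the
  curvature functions once.\<close>

lemma smooth_within_derivative:
  assumes "smooth_within I g"
  obtains g' where "\<And>s. s \<in> I \<Longrightarrow> (g has_vector_derivative g' s) (at s within I)"
    "\<And>s. s \<in> I \<Longrightarrow> g' differentiable (at s within I)"
proof -
  obtain D where D: "\<And>s. s \<in> I \<Longrightarrow> D 0 s = g s"
    "\<And>k s. s \<in> I \<Longrightarrow> (D k has_vector_derivative D (Suc k) s) (at s within I)"
    using assms unfolding smooth_within_def by metis
  show ?thesis
  proof
    fix s assume s: "s \<in> I"
    show "(g has_vector_derivative D 1 s) (at s within I)"
      using has_vector_derivative_transform[OF s D(1)[symmetric] D(2)[OF s, of 0]] by simp
    show "D 1 differentiable (at s within I)"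
      using D(2)[OF s, of 1] by (auto intro: differentiableI_vector)
  qed
qed


section \<open>The adapted frame\<close>

text \<open>Each product is a determinant with a repeated row.\<close>

lemma pip_triple_prod_eq_0:
  "pip u (triple_prod u v w) = 0" "pip v (triple_prod u v w) = 0" "pip w (triple_prod u v w) = 0"
proof -
  have eq0: "det (A :: real^4^4) = 0" if "A $ i = A $ j" "i \<noteq> j" for A i j
    using that det_identical_rows[of i j A] by (simp add: row_def vec_eq_iff)
  show "pip u (triple_prod u v w) = 0"
    unfolding pip_triple_prod by (rule eq0[of _ 1 2]) (simp_all add: vector_4_nth)
  show "pip v (triple_prod u v w) = 0"
    unfolding pip_triple_prod by (rule eq0[of _ 1 3]) (simp_all add: vector_4_nth)
  show "pip w (triple_prod u v w) = 0"
    unfolding pip_triple_prod by (rule eq0[of _ 1 4]) (simp_all add: vector_4_nth)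
qed

lemma framed_immersion_pip:
  assumes "timelike_framed_immersion I \<gamma> f1 f2" "s \<in> I"
  shows "pip (\<gamma> s) (\<gamma> s) = -1" "pip (f1 s) (f1 s) = 1" "pip (f2 s) (f2 s) = 1"
    "pip (\<gamma> s) (f1 s) = 0" "pip (f1 s) (\<gamma> s) = 0" "pip (\<gamma> s) (f2 s) = 0"
    "pip (f2 s) (\<gamma> s) = 0" "pip (f1 s) (f2 s) = 0" "pip (f2 s) (f1 s) = 0"
  using assms
  by (auto simp: timelike_framed_immersion_def AdS3_def Delta5_def S32_def pip_commute)

lemma has_curvatureD:
  assumes "has_curvature I \<gamma> f1 f2 (\<alpha>, l, \<lambda>_. 0, n)" "s \<in> I"
  shows "(\<gamma> has_vector_derivative \<alpha> s *\<^sub>R frame_mu \<gamma> f1 f2 s) (at s within I)"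
    "(f1 has_vector_derivative l s *\<^sub>R f2 s) (at s within I)"
    "(f2 has_vector_derivative n s *\<^sub>R frame_mu \<gamma> f1 f2 s - l s *\<^sub>R f1 s) (at s within I)"
    "(frame_mu \<gamma> f1 f2 has_vector_derivative n s *\<^sub>R f2 s - \<alpha> s *\<^sub>R \<gamma> s) (at s within I)"
  using assms by (auto simp: has_curvature_def Let_def)

text \<open>Differentiating \<open>\<langle>f\<^sub>2, \<mu>\<rangle> = 0\<close> gives \<open>n (\<langle>\<mu>, \<mu>\<rangle> + 1) = 0\<close>; this avoids a Gram
  determinant.\<close>

lemma pip_frame_mu:
  assumes "at s within I \<noteq> bot" "timelike_framed_immersion I \<gamma> f1 f2"
    "has_curvature I \<gamma> f1 f2 (\<alpha>, l, \<lambda>_. 0, n)" "s \<in> I" "n s \<noteq> 0"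
  shows "pip (frame_mu \<gamma> f1 f2 s) (frame_mu \<gamma> f1 f2 s) = -1"
proof -
  let ?\<mu> = "frame_mu \<gamma> f1 f2"
  have orth: "pip (f1 t) (?\<mu> t) = 0" "pip (f2 t) (?\<mu> t) = 0" for t
    by (simp_all add: frame_mu_def pip_triple_prod_eq_0)
  note c = has_curvatureD[OF assms(3,4)]
  have "((\<lambda>t. pip (f2 t) (?\<mu> t)) has_vector_derivative
      pip (f2 s) (n s *\<^sub>R f2 s - \<alpha> s *\<^sub>R \<gamma> s) + pip (n s *\<^sub>R ?\<mu> s - l s *\<^sub>R f1 s) (?\<mu> s))
      (at s within I)"
    by (rule bounded_bilinear.has_vector_derivative[OF bounded_bilinear_pip c(3,4)])
  moreover have "((\<lambda>t. pip (f2 t) (?\<mu> t)) has_vector_derivative 0) (at s within I)"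
    by (simp add: orth)
  ultimately have
    "pip (f2 s) (n s *\<^sub>R f2 s - \<alpha> s *\<^sub>R \<gamma> s) + pip (n s *\<^sub>R ?\<mu> s - l s *\<^sub>R f1 s) (?\<mu> s) = 0"
    using vector_derivative_unique_within assms(1) by blast
  then have "n s * (pip (?\<mu> s) (?\<mu> s) + 1) = 0"
    by (simp add: pip_simps orth framed_immersion_pip[OF assms(2,4)] algebra_simps)
  then show ?thesis
    using assms(5) by simp
qed

text \<open>Regularity of the curvature comes from the frame: as \<open>\<mu>\<close> has square -1,
  \<open>\<alpha>\<close> is minus the product of \<open>\<gamma>'\<close> with
  \<open>\<mu>\<close>, and \<open>n\<close> minus that of \<open>f2'\<close> with
  \<open>\<mu>\<close>. Smoothness makes \<open>\<gamma>'\<close> and \<open>f2'\<close>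
  differentiable, and the last Frenet equation does so for \<open>\<mu>\<close>. The condition that
  \<open>n\<close> has no zero enters through \<open>pip_frame_mu\<close>.\<close>

lemma curvature_differentiable:
  assumes "is_interval I" "interior I \<noteq> {}" "timelike_framed_immersion I \<gamma> f1 f2"
    "has_curvature I \<gamma> f1 f2 (\<alpha>, l, \<lambda>_. 0, n)" "\<And>s. s \<in> I \<Longrightarrow> n s \<noteq> 0" "s \<in> I"
  shows "\<alpha> differentiable (at s within I)" "n differentiable (at s within I)"
proof -
  let ?\<mu> = "frame_mu \<gamma> f1 f2"
  have nb: "at t within I \<noteq> bot" if "t \<in> I" for t
    using at_within_interval_neq_bot assms(1,2) that by blast
  have \<mu>\<mu>: "pip (?\<mu> t) (?\<mu> t) = -1" if "t \<in> I" for t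
    using pip_frame_mu[OF nb[OF that] assms(3,4) that] assms(5) that by blast
  have f1\<mu>: "pip (f1 t) (?\<mu> t) = 0" for t
    by (simp add: frame_mu_def pip_triple_prod_eq_0)
  obtain g' where g':
    "\<And>t. t \<in> I \<Longrightarrow> ((\<lambda>s. (\<gamma> s, f1 s, f2 s)) has_vector_derivative g' t) (at t within I)"
    "\<And>t. t \<in> I \<Longrightarrow> g' differentiable (at t within I)"
    using assms(3) smooth_within_derivative unfolding timelike_framed_immersion_def by blast
  have g'_eq: "g' t = (\<alpha> t *\<^sub>R ?\<mu> t, l t *\<^sub>R f2 t, n t *\<^sub>R ?\<mu> t - l t *\<^sub>R f1 t)" if "t \<in> I" for t
    using has_curvatureD[OF assms(4) that]
    by (intro vector_derivative_unique_within[OF nb[OF that] g'(1)[OF that]]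
          has_vector_derivative_Pair)
  \<comment> \<open>The map \<open>p\<close> will be the projection to the first component for
    \<open>\<alpha>\<close> and to the third for \<open>n\<close>.\<close>
  have diff: "(\<lambda>t. - pip (p (g' t)) (?\<mu> t)) differentiable (at s within I)"
    if p: "bounded_linear p" for p :: "_ \<Rightarrow> real^4"
  proof -
    have "(g' has_vector_derivative vector_derivative g' (at s within I)) (at s within I)"
      using g'(2)[OF assms(6)] by (simp add: vector_derivative_works)
    note bounded_linear.has_vector_derivative[OF p this]
    note bounded_bilinear.has_vector_derivative
      [OF bounded_bilinear_pip this has_curvatureD(4)[OF assms(4,6)]]
    from has_vector_derivative_minus[OF this] show ?thesis
      by (rule differentiableI_vector)
  qed
  have "\<alpha> t = - pip (fst (g' t)) (?\<mu> t)" if "t \<in> I" for t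
    by (simp add: g'_eq[OF that] pip_simps \<mu>\<mu>[OF that])
  \<comment> \<open>The formula holds on all of \<open>I\<close>, so the radius of the neighbourhood
    is arbitrary; 1 is taken.\<close>
  then show "\<alpha> differentiable (at s within I)"
    by (intro differentiable_transform_within[OF diff[OF bounded_linear_fst] zero_less_one assms(6)])
      simp
  have "n t = - pip (snd (snd (g' t))) (?\<mu> t)" if "t \<in> I" for t
    by (simp add: g'_eq[OF that] pip_simps \<mu>\<mu>[OF that] f1\<mu>)
  then show "n differentiable (at s within I)"
    by (intro differentiable_transform_within[OF diff[OF
          bounded_linear_compose[OF bounded_linear_snd bounded_linear_snd]] zero_less_one assms(6)])
      simp
qed


section \<open>Derivatives of the focal surface\<close>

text \<open>Up to a common sign, \<open>focal_zeta\<close> and \<open>focal_eta\<close> arise from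
  \<open>\<gamma>\<close> and \<open>f2\<close> by the hyperbolic rotation of their plane whose
  angle has tanh equal to \<open>- \<alpha> / n\<close>.\<close>

definition focal_eta ::
    "(real \<Rightarrow> real^4) \<Rightarrow> (real \<Rightarrow> real^4) \<Rightarrow> (real \<Rightarrow> real) \<Rightarrow> (real \<Rightarrow> real) \<Rightarrow> real \<Rightarrow> real^4" where
  "focal_eta \<gamma> f2 \<alpha> n s =
    (1 / sqrt ((n s)\<^sup>2 - (\<alpha> s)\<^sup>2)) *\<^sub>R (n s *\<^sub>R f2 s - \<alpha> s *\<^sub>R \<gamma> s)"

definition focal_theta_deriv ::
    "(real \<Rightarrow> real^4) \<Rightarrow> (real \<Rightarrow> real^4) \<Rightarrow> (real \<Rightarrow> real^4) \<Rightarrow> (real \<Rightarrow> real) \<Rightarrow> (real \<Rightarrow> real) \<Rightarrow>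
      real \<Rightarrow> real \<Rightarrow> real^4" where
  "focal_theta_deriv \<gamma> f1 f2 \<alpha> n s \<theta> = sinh \<theta> *\<^sub>R focal_zeta \<gamma> f2 \<alpha> n s + cosh \<theta> *\<^sub>R f1 s"

lemma focal_surface_deriv_theta:
  "((\<lambda>\<theta>. focal_surface \<gamma> f1 f2 \<alpha> n (s, \<theta>)) has_vector_derivative
     focal_theta_deriv \<gamma> f1 f2 \<alpha> n s \<theta>) (at \<theta>)"
  unfolding focal_surface_def focal_theta_deriv_def prod.case
  by (auto intro!: derivative_eq_intros)

text \<open>The coefficient of \<open>focal_eta\<close> is the derivative of the rotation angle
  artanh \<open>(- \<alpha> / n)\<close>; the \<open>f1\<close> term comes from
  \<open>f2'\<close>.\<close>

lemma focal_zeta_deriv: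
  assumes "has_curvature I \<gamma> f1 f2 (\<alpha>, l, \<lambda>_. 0, n)" "s \<in> I" "(n s)\<^sup>2 > (\<alpha> s)\<^sup>2"
    "\<alpha> differentiable (at s within I)" "n differentiable (at s within I)"
  shows "(focal_zeta \<gamma> f2 \<alpha> n has_vector_derivative
     (wronskian I \<alpha> n s / ((n s)\<^sup>2 - (\<alpha> s)\<^sup>2)) *\<^sub>R focal_eta \<gamma> f2 \<alpha> n s +
     (\<alpha> s * l s / sqrt ((n s)\<^sup>2 - (\<alpha> s)\<^sup>2)) *\<^sub>R f1 s) (at s within I)"
proof -
  define a' n' where "a' = vector_derivative \<alpha> (at s within I)"
    and "n' = vector_derivative n (at s within I)"
  define D where "D = (n s)\<^sup>2 - (\<alpha> s)\<^sup>2"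
  define r where "r = sqrt D"
  have D: "D > 0" using assms(3) by (simp add: D_def)
  then have r: "r > 0" "r * r = D" by (simp_all add: r_def)
  have a': "(\<alpha> has_real_derivative a') (at s within I)"
    using assms(4) by (simp add: a'_def vector_derivative_works has_real_derivative_iff_has_vector_derivative)
  have n': "(n has_real_derivative n') (at s within I)"
    using assms(5) by (simp add: n'_def vector_derivative_works has_real_derivative_iff_has_vector_derivative)
  note c = has_curvatureD[OF assms(1,2)]
  define w where "w = \<alpha> s * n' - n s * a'"
  \<comment> \<open>The derivative of \<open>D\<close> to the power -1/2; the denominator
    \<open>r * D\<close> is \<open>D\<close> to the power 3/2.\<close>
  define b where "b = - (n s * n' - \<alpha> s * a') / (r * D)"
  have "((\<lambda>t. 1 / sqrt ((n t)\<^sup>2 - (\<alpha> t)\<^sup>2)) has_real_derivative b) (at s within I)"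
    using r D
    by (auto intro!: derivative_eq_intros a' n' simp: b_def r_def D_def[symmetric] field_simps)
  \<comment> \<open>The terms along \<open>\<mu>\<close> cancel:
    \<open>n *\<^sub>R \<gamma>'\<close> and \<open>\<alpha> *\<^sub>R f2'\<close> both contribute
    \<open>n * \<alpha>\<close> times \<open>\<mu>\<close>.\<close>
  moreover have "((\<lambda>t. n t *\<^sub>R \<gamma> t - \<alpha> t *\<^sub>R f2 t) has_vector_derivative
      n' *\<^sub>R \<gamma> s - a' *\<^sub>R f2 s + (\<alpha> s * l s) *\<^sub>R f1 s) (at s within I)"
    by (auto intro!: derivative_eq_intros a' n' c(1,3) simp: algebra_simps)
  ultimately have "(focal_zeta \<gamma> f2 \<alpha> n has_vector_derivative
      (1 / r) *\<^sub>R (n' *\<^sub>R \<gamma> s - a' *\<^sub>R f2 s + (\<alpha> s * l s) *\<^sub>R f1 s) +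
      b *\<^sub>R (n s *\<^sub>R \<gamma> s - \<alpha> s *\<^sub>R f2 s)) (at s within I)"
    unfolding focal_zeta_def[abs_def] r_def D_def by (rule has_vector_derivative_scaleR)
  moreover have "(1 / r) *\<^sub>R (n' *\<^sub>R \<gamma> s - a' *\<^sub>R f2 s + (\<alpha> s * l s) *\<^sub>R f1 s) +
      b *\<^sub>R (n s *\<^sub>R \<gamma> s - \<alpha> s *\<^sub>R f2 s) =
      (w / D) *\<^sub>R focal_eta \<gamma> f2 \<alpha> n s + (\<alpha> s * l s / r) *\<^sub>R f1 s"
  proof -
    \<comment> \<open>The coefficients of \<open>\<gamma>\<close> and \<open>f2\<close> are compared
      separately; over the denominator \<open>r * D\<close> each numerator contains the factor
      \<open>w\<close>.\<close>
    have "n' / r + b * n s = (n' * D - (n s * n' - \<alpha> s * a') * n s) / (r * D)"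
      using r(1) D by (simp add: b_def field_simps)
    also have "n' * D - (n s * n' - \<alpha> s * a') * n s = - (\<alpha> s * w)"
      by (simp add: D_def w_def power2_eq_square algebra_simps)
    finally have c1: "n' / r + b * n s = - (\<alpha> s * w) / (r * D)" .
    have "a' / r + b * \<alpha> s = (a' * D - (n s * n' - \<alpha> s * a') * \<alpha> s) / (r * D)"
      using r(1) D by (simp add: b_def field_simps)
    also have "a' * D - (n s * n' - \<alpha> s * a') * \<alpha> s = - (n s * w)"
      by (simp add: D_def w_def power2_eq_square algebra_simps)
    finally have c2: "a' / r + b * \<alpha> s = - (n s * w) / (r * D)" .
    have "(1 / r) *\<^sub>R (n' *\<^sub>R \<gamma> s - a' *\<^sub>R f2 s + (\<alpha> s * l s) *\<^sub>R f1 s) +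
        b *\<^sub>R (n s *\<^sub>R \<gamma> s - \<alpha> s *\<^sub>R f2 s) =
        (n' / r + b * n s) *\<^sub>R \<gamma> s - (a' / r + b * \<alpha> s) *\<^sub>R f2 s + (\<alpha> s * l s / r) *\<^sub>R f1 s"
      by (simp add: algebra_simps)
    then show ?thesis
      unfolding c1 c2 focal_eta_def D_def[symmetric] r_def[symmetric]
      by (simp add: algebra_simps)
  qed
  ultimately show ?thesis
    unfolding wronskian_def a'_def[symmetric] n'_def[symmetric] D_def[symmetric]
      r_def[symmetric] w_def[symmetric]
    by simp
qed

text \<open>Once \<open>f2\<close> in \<open>f1' = l f2\<close> is split along
  \<open>focal_eta\<close> and \<open>focal_zeta\<close>, the \<open>focal_zeta\<close> and
  \<open>f1\<close> terms together form a multiple of the derivative in \<theta>. Only the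
  \<open>focal_eta\<close> component is transversal to it.\<close>

lemma focal_surface_deriv_s:
  assumes "has_curvature I \<gamma> f1 f2 (\<alpha>, l, \<lambda>_. 0, n)" "s \<in> I" "(n s)\<^sup>2 > (\<alpha> s)\<^sup>2"
    "\<alpha> differentiable (at s within I)" "n differentiable (at s within I)"
  defines "D \<equiv> (n s)\<^sup>2 - (\<alpha> s)\<^sup>2"
  shows "((\<lambda>s. focal_surface \<gamma> f1 f2 \<alpha> n (s, \<theta>)) has_vector_derivative
     ((wronskian I \<alpha> n s * cosh \<theta> + l s * n s * sqrt D * sinh \<theta>) / D) *\<^sub>R focal_eta \<gamma> f2 \<alpha> n s +
     (\<alpha> s * l s / sqrt D) *\<^sub>R focal_theta_deriv \<gamma> f1 f2 \<alpha> n s \<theta>) (at s within I)"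
proof -
  define r where "r = sqrt D"
  have D: "D > 0" using assms(3) by (simp add: D_def)
  then have r: "r > 0" "r * r = D" by (simp_all add: r_def)
  \<comment> \<open>This inverts the hyperbolic rotation.\<close>
  have f2_eq: "f2 s = (n s / r) *\<^sub>R focal_eta \<gamma> f2 \<alpha> n s + (\<alpha> s / r) *\<^sub>R focal_zeta \<gamma> f2 \<alpha> n s"
  proof -
    have "(n s / r) *\<^sub>R focal_eta \<gamma> f2 \<alpha> n s + (\<alpha> s / r) *\<^sub>R focal_zeta \<gamma> f2 \<alpha> n s =
        ((n s * n s - \<alpha> s * \<alpha> s) / (r * r)) *\<^sub>R f2 s"
      unfolding focal_eta_def focal_zeta_def D_def[symmetric] r_def[symmetric]
      by (simp add: algebra_simps diff_divide_distrib)
    then show ?thesis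
      using D by (simp add: r(2) D_def power2_eq_square)
  qed
  have "((\<lambda>s. focal_surface \<gamma> f1 f2 \<alpha> n (s, \<theta>)) has_vector_derivative
      cosh \<theta> *\<^sub>R ((wronskian I \<alpha> n s / D) *\<^sub>R focal_eta \<gamma> f2 \<alpha> n s + (\<alpha> s * l s / r) *\<^sub>R f1 s) +
      sinh \<theta> *\<^sub>R (l s *\<^sub>R f2 s)) (at s within I)"
    unfolding focal_surface_def prod.case D_def r_def
    by (auto intro!: derivative_eq_intros has_curvatureD(2)[OF assms(1,2)]
        focal_zeta_deriv[OF assms(1-5)])
  moreover have "cosh \<theta> *\<^sub>R ((wronskian I \<alpha> n s / D) *\<^sub>R focal_eta \<gamma> f2 \<alpha> n s +
        (\<alpha> s * l s / r) *\<^sub>R f1 s) + sinh \<theta> *\<^sub>R (l s *\<^sub>R f2 s) =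
      ((wronskian I \<alpha> n s * cosh \<theta> + l s * n s * r * sinh \<theta>) / D) *\<^sub>R focal_eta \<gamma> f2 \<alpha> n s +
      (\<alpha> s * l s / r) *\<^sub>R focal_theta_deriv \<gamma> f1 f2 \<alpha> n s \<theta>"
    unfolding focal_theta_deriv_def
    by (subst f2_eq, use r in \<open>simp add: algebra_simps add_divide_distrib flip: r(2)\<close>)
  ultimately show ?thesis
    by (simp add: r_def)
qed

text \<open>These products let coefficients be read off by pairing. As \<open>pip\<close> is
  indefinite, orthogonality alone would not give linear independence; the squares being 1
  does.\<close>

lemma focal_frame_pip:
  assumes "timelike_framed_immersion I \<gamma> f1 f2" "s \<in> I" "(n s)\<^sup>2 > (\<alpha> s)\<^sup>2"
  shows "pip (focal_theta_deriv \<gamma> f1 f2 \<alpha> n s \<theta>) (focal_theta_deriv \<gamma> f1 f2 \<alpha> n s \<theta>) = 1"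
    "pip (focal_eta \<gamma> f2 \<alpha> n s) (focal_eta \<gamma> f2 \<alpha> n s) = 1"
    "pip (focal_eta \<gamma> f2 \<alpha> n s) (focal_theta_deriv \<gamma> f1 f2 \<alpha> n s \<theta>) = 0"
proof -
  note p = framed_immersion_pip[OF assms(1,2)]
  have z: "pip (focal_zeta \<gamma> f2 \<alpha> n s) (f1 s) = 0" "pip (f1 s) (focal_zeta \<gamma> f2 \<alpha> n s) = 0"
    by (simp_all add: focal_zeta_def pip_simps p)
  have zz: "pip (focal_zeta \<gamma> f2 \<alpha> n s) (focal_zeta \<gamma> f2 \<alpha> n s) = -1"
    using focal_zeta_timelike[of I \<gamma> f1 f2 s \<alpha> n] assms by blast
  show "pip (focal_theta_deriv \<gamma> f1 f2 \<alpha> n s \<theta>) (focal_theta_deriv \<gamma> f1 f2 \<alpha> n s \<theta>) = 1"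
    using cosh_square_eq[of \<theta>]
    by (simp add: focal_theta_deriv_def pip_simps z zz p power2_eq_square)
  define r where "r = sqrt ((n s)\<^sup>2 - (\<alpha> s)\<^sup>2)"
  have r: "r > 0" "r * r = n s * n s - \<alpha> s * \<alpha> s"
    using assms(3) by (simp_all add: r_def power2_eq_square)
  show "pip (focal_eta \<gamma> f2 \<alpha> n s) (focal_eta \<gamma> f2 \<alpha> n s) = 1"
    using r by (simp add: focal_eta_def pip_simps p flip: r_def) (simp add: field_simps)
  show "pip (focal_eta \<gamma> f2 \<alpha> n s) (focal_theta_deriv \<gamma> f1 f2 \<alpha> n s \<theta>) = 0"
    by (simp add: focal_eta_def focal_theta_deriv_def focal_zeta_def pip_simps p)
qed


section \<open>Singular points\<close>

text \<open>Write the derivatives in s and \<theta> as \<open>c *\<^sub>R e + k *\<^sub>R T\<close>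
  and \<open>T\<close>. Pairing a linear relation with \<open>e\<close> and \<open>T\<close> gives
  \<open>a * c = 0\<close> and \<open>a * k + b = 0\<close>; if \<open>a\<close> were 0, so would be
  \<open>b\<close>, hence \<open>c = 0\<close>. Conversely, \<open>c = 0\<close> makes the first
  derivative \<open>k\<close> times the second.\<close>

lemma singular_focal_surface_iff:
  assumes "is_interval I" "interior I \<noteq> {}" "timelike_framed_immersion I \<gamma> f1 f2"
    "has_curvature I \<gamma> f1 f2 (\<alpha>, l, \<lambda>_. 0, n)" "\<And>s. s \<in> I \<Longrightarrow> (n s)\<^sup>2 > (\<alpha> s)\<^sup>2" "s \<in> I"
  shows "singular_point I (focal_surface \<gamma> f1 f2 \<alpha> n) (s, \<theta>) \<longleftrightarrow>
    wronskian I \<alpha> n s * cosh \<theta> + l s * n s * sqrt ((n s)\<^sup>2 - (\<alpha> s)\<^sup>2) * sinh \<theta> = 0"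
proof -
  define D where "D = (n s)\<^sup>2 - (\<alpha> s)\<^sup>2"
  define c where "c = (wronskian I \<alpha> n s * cosh \<theta> + l s * n s * sqrt D * sinh \<theta>) / D"
  define k where "k = \<alpha> s * l s / sqrt D"
  define e where "e = focal_eta \<gamma> f2 \<alpha> n s"
  define T where "T = focal_theta_deriv \<gamma> f1 f2 \<alpha> n s \<theta>"
  have D: "D > 0" using assms(5,6) by (simp add: D_def)
  have "n t \<noteq> 0" if "t \<in> I" for t
    using assms(5)[OF that] zero_le_power2[of "\<alpha> t"] by (auto simp del: zero_le_power2)
  note diff = curvature_differentiable[OF assms(1-4) this assms(6)]
  have ds: "vector_derivative (\<lambda>s. focal_surface \<gamma> f1 f2 \<alpha> n (s, \<theta>)) (at s within I) =
      c *\<^sub>R e + k *\<^sub>R T"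
    unfolding c_def k_def e_def T_def D_def
    by (intro vector_derivative_within at_within_interval_neq_bot[OF assms(1,2,6)]
        focal_surface_deriv_s[OF assms(4,6) assms(5)[OF assms(6)] diff])
  have dt: "vector_derivative (\<lambda>\<theta>. focal_surface \<gamma> f1 f2 \<alpha> n (s, \<theta>)) (at \<theta>) = T"
    unfolding T_def by (rule vector_derivative_at[OF focal_surface_deriv_theta])
  have p: "pip T T = 1" "pip e e = 1" "pip e T = 0"
    unfolding e_def T_def
    by (intro focal_frame_pip[where n = n and \<alpha> = \<alpha>, OF assms(3,6) assms(5)[OF assms(6)]])+
  have "(\<exists>a b. (a \<noteq> 0 \<or> b \<noteq> 0) \<and> a *\<^sub>R (c *\<^sub>R e + k *\<^sub>R T) + b *\<^sub>R T = 0) \<longleftrightarrow> c = 0"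
  proof
    assume "\<exists>a b. (a \<noteq> 0 \<or> b \<noteq> 0) \<and> a *\<^sub>R (c *\<^sub>R e + k *\<^sub>R T) + b *\<^sub>R T = 0"
    then obtain a b where ab: "a \<noteq> 0 \<or> b \<noteq> 0" and
      0: "a *\<^sub>R (c *\<^sub>R e + k *\<^sub>R T) + b *\<^sub>R T = 0" by blast
    have "pip e (a *\<^sub>R (c *\<^sub>R e + k *\<^sub>R T) + b *\<^sub>R T) = a * c"
      by (simp add: pip_simps p)
    moreover have "pip T (a *\<^sub>R (c *\<^sub>R e + k *\<^sub>R T) + b *\<^sub>R T) = a * k + b"
      by (simp add: pip_simps p pip_commute[of T e])
    ultimately have "a * c = 0" "a * k + b = 0"
      unfolding 0 by (simp_all add: pip_def)
    then show "c = 0"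
      using ab by auto
  next
    assume "c = 0"
    then have "(1::real) *\<^sub>R (c *\<^sub>R e + k *\<^sub>R T) + (- k) *\<^sub>R T = 0" by simp
    then show "\<exists>a b. (a \<noteq> 0 \<or> b \<noteq> 0) \<and> a *\<^sub>R (c *\<^sub>R e + k *\<^sub>R T) + b *\<^sub>R T = 0"
      using zero_neq_one by metis
  qed
  then show ?thesis
    using D unfolding singular_point_def prod.case ds dt by (simp add: c_def D_def)
qed

text \<open>Both functions are expressed through \<open>e = exp (- 2 * artanh x)\<close>, which
  equals \<open>(1 - x) / (1 + x)\<close>. Needed for the angle at which a singular point
  lies.\<close>

lemma tanh_artanh_real:
  fixes x :: real
  assumes "\<bar>x\<bar> < 1"
  shows "tanh (artanh x) = x"
proof -
  define e where "e = exp (- 2 * artanh x)"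
  have "e = (1 - x) / (1 + x)"
    using assms by (simp add: e_def artanh_def exp_minus)
  then have "e * (1 + x) = 1 - x"
    using assms by simp
  then have "1 - e = x * (1 + e)"
    by (simp add: algebra_simps)
  moreover have "1 + e > 0"
    by (simp add: e_def add_pos_pos)
  ultimately show ?thesis
    unfolding tanh_real_altdef e_def[symmetric] by (simp add: divide_eq_eq)
qed

text \<open>The equation says that (cosh \<theta>, sinh \<theta>) is parallel to (p, -q). Since cosh
  squared minus sinh squared is 1, that direction must have positive pseudo-norm, and the factor is
  determined up to the sign \<open>\<epsilon>\<close>.\<close>

lemma cosh_sinh_proportional_iff:
  fixes p q \<theta> :: real
  assumes "q\<^sup>2 - p\<^sup>2 \<noteq> 0"
  shows "q * cosh \<theta> + p * sinh \<theta> = 0 \<longleftrightarrow> q\<^sup>2 - p\<^sup>2 < 0 \<and>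
    (\<exists>\<epsilon>\<in>{1, -1}. cosh \<theta> = \<epsilon> * (p / sqrt (p\<^sup>2 - q\<^sup>2)) \<and> sinh \<theta> = - \<epsilon> * (q / sqrt (p\<^sup>2 - q\<^sup>2)))"
    (is "?L \<longleftrightarrow> ?R")
proof
  assume L: ?L
  have "(q * cosh \<theta>)\<^sup>2 = (p * sinh \<theta>)\<^sup>2"
    using L by (simp add: eq_neg_iff_add_eq_0[symmetric])
  \<comment> \<open>Eliminating sinh yields both the sign of \<open>p\<^sup>2 - q\<^sup>2\<close>
    and, after a square root, \<open>p\<close> up to sign.\<close>
  then have *: "(p\<^sup>2 - q\<^sup>2) * (cosh \<theta>)\<^sup>2 = p\<^sup>2"
    by (simp add: power_mult_distrib cosh_square_eq algebra_simps)
  have ch: "(cosh \<theta>)\<^sup>2 > 0" by simp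
  have "p\<^sup>2 - q\<^sup>2 \<ge> 0"
    using * ch by (metis zero_le_power2 zero_le_mult_iff not_le)
  then have pos: "p\<^sup>2 - q\<^sup>2 > 0" using assms by simp
  define r where "r = sqrt (p\<^sup>2 - q\<^sup>2)"
  have r: "r > 0" "r\<^sup>2 = p\<^sup>2 - q\<^sup>2" using pos by (simp_all add: r_def)
  have "(r * cosh \<theta>)\<^sup>2 = p\<^sup>2"
    using * by (simp add: power_mult_distrib r)
  then have pe: "p = r * cosh \<theta> \<or> p = - (r * cosh \<theta>)"
    by (auto simp: power2_eq_iff)
  have ch0: "cosh \<theta> \<noteq> 0" using ch by auto
  \<comment> \<open>The sign in \<open>p\<close> serves as \<open>\<epsilon>\<close>; the linear
    equation, with the nonzero factor \<open>cosh \<theta>\<close> cancelled, then fixes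
    \<open>q\<close>.\<close>
  have "\<exists>\<epsilon>\<in>{1, -1}. p = \<epsilon> * r * cosh \<theta> \<and> q = - \<epsilon> * r * sinh \<theta>"
    using pe
  proof
    assume p: "p = r * cosh \<theta>"
    have "cosh \<theta> * (q + r * sinh \<theta>) = 0"
      using L by (simp add: p algebra_simps)
    then have "q + r * sinh \<theta> = 0"
      using ch0 by simp
    then show ?thesis
      using p by simp
  next
    assume p: "p = - (r * cosh \<theta>)"
    have "cosh \<theta> * (q - r * sinh \<theta>) = 0"
      using L by (simp add: p algebra_simps)
    then have "q = r * sinh \<theta>"
      using ch0 by simp
    then show ?thesis
      using p by simp
  qed
  then show ?R
    using pos r(1) unfolding r_def[symmetric] by (auto simp: field_simps)
next
  assume ?R
  then show ?L by auto
qed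

theorem mainTheorem17:
  fixes I :: "real set"
    and \<gamma> f1 f2 :: "real \<Rightarrow> real^4"
    and \<alpha> l n :: "real \<Rightarrow> real"
  assumes "is_interval I" and "interior I \<noteq> {}"
    and "timelike_framed_immersion I \<gamma> f1 f2"
    and "has_curvature I \<gamma> f1 f2 (\<alpha>, l, \<lambda>_. 0, n)"
    and "\<And>s. s \<in> I \<Longrightarrow> (n s)\<^sup>2 > (\<alpha> s)\<^sup>2"
    and "\<And>s. s \<in> I \<Longrightarrow> evolute_disc I \<alpha> l n s \<noteq> 0"
  shows "(\<forall>s\<^sub>0\<in>I. \<forall>\<theta>\<^sub>0.
      singular_point I (focal_surface \<gamma> f1 f2 \<alpha> n) (s\<^sub>0, \<theta>\<^sub>0) \<longleftrightarrow>
        evolute_disc I \<alpha> l n s\<^sub>0 < 0 \<and>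
        focal_surface \<gamma> f1 f2 \<alpha> n (s\<^sub>0, \<theta>\<^sub>0) \<in>
          {AdS_evolute I \<gamma> f1 f2 \<alpha> l n s\<^sub>0, - AdS_evolute I \<gamma> f1 f2 \<alpha> l n s\<^sub>0}) \<and>
    (\<forall>s\<^sub>0\<in>I. evolute_disc I \<alpha> l n s\<^sub>0 < 0 \<longrightarrow>
      (\<exists>\<theta>\<^sub>0. singular_point I (focal_surface \<gamma> f1 f2 \<alpha> n) (s\<^sub>0, \<theta>\<^sub>0) \<and>
        focal_surface \<gamma> f1 f2 \<alpha> n (s\<^sub>0, \<theta>\<^sub>0) \<in>
          {AdS_evolute I \<gamma> f1 f2 \<alpha> l n s\<^sub>0, - AdS_evolute I \<gamma> f1 f2 \<alpha> l n s\<^sub>0}))"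
proof -
  have main: "(singular_point I (focal_surface \<gamma> f1 f2 \<alpha> n) (s, \<theta>) \<longleftrightarrow>
        evolute_disc I \<alpha> l n s < 0 \<and>
        focal_surface \<gamma> f1 f2 \<alpha> n (s, \<theta>) \<in>
          {AdS_evolute I \<gamma> f1 f2 \<alpha> l n s, - AdS_evolute I \<gamma> f1 f2 \<alpha> l n s})"
    and ex: "evolute_disc I \<alpha> l n s < 0 \<Longrightarrow>
        \<exists>\<theta>. singular_point I (focal_surface \<gamma> f1 f2 \<alpha> n) (s, \<theta>)"
    if s: "s \<in> I" for s \<theta>
  proof -
    define D where "D = (n s)\<^sup>2 - (\<alpha> s)\<^sup>2"
    \<comment> \<open>With these abbreviations \<open>evolute_disc\<close> is
      \<open>q\<^sup>2 - p\<^sup>2\<close> and the evolute is \<open>z\<close> and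
      \<open>f1 s\<close> with coefficients \<open>p / r\<close> and \<open>- (q / r)\<close>, as in
      \<open>cosh_sinh_proportional_iff\<close>.\<close>
    define p where "p = l s * n s * sqrt D"
    define q where "q = wronskian I \<alpha> n s"
    define r where "r = sqrt (p\<^sup>2 - q\<^sup>2)"
    define z where "z = focal_zeta \<gamma> f2 \<alpha> n s"
    have D: "D > 0" using assms(5)[OF s] by (simp add: D_def)
    have disc: "evolute_disc I \<alpha> l n s = q\<^sup>2 - p\<^sup>2"
      using D by (simp add: evolute_disc_def p_def q_def power_mult_distrib flip: D_def)
    have sing: "singular_point I (focal_surface \<gamma> f1 f2 \<alpha> n) (s, \<theta>) \<longleftrightarrow>
        q * cosh \<theta> + p * sinh \<theta> = 0" for \<theta>
      using singular_focal_surface_iff[OF assms(1-5) s] by (simp add: p_def q_def D_def)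
    have "n s *\<^sub>R \<gamma> s - \<alpha> s *\<^sub>R f2 s = sqrt D *\<^sub>R z"
      using D by (simp add: z_def focal_zeta_def flip: D_def)
    then have E: "AdS_evolute I \<gamma> f1 f2 \<alpha> l n s = (p / r) *\<^sub>R z - (q / r) *\<^sub>R f1 s"
      by (simp add: AdS_evolute_def disc p_def r_def algebra_simps flip: q_def)
    have zz: "pip z z = -1"
      using focal_zeta_timelike[of I \<gamma> f1 f2 s \<alpha> n] assms(3,5) s by (simp add: z_def)
    note fp = framed_immersion_pip[OF assms(3) s]
    have zf: "pip z (f1 s) = 0"
      by (simp add: z_def focal_zeta_def pip_simps fp)
    \<comment> \<open>Orthogonal vectors of squares -1 and 1 are independent, so equality of points
      becomes equality of coefficients.\<close>
    have comb: "a *\<^sub>R z + b *\<^sub>R f1 s = c *\<^sub>R z + d *\<^sub>R f1 s \<longleftrightarrow> a = c \<and> b = d" for a b c d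
    proof
      assume "a *\<^sub>R z + b *\<^sub>R f1 s = c *\<^sub>R z + d *\<^sub>R f1 s"
      then have "pip z (a *\<^sub>R z + b *\<^sub>R f1 s) = pip z (c *\<^sub>R z + d *\<^sub>R f1 s)"
        "pip (f1 s) (a *\<^sub>R z + b *\<^sub>R f1 s) = pip (f1 s) (c *\<^sub>R z + d *\<^sub>R f1 s)" by simp_all
      then show "a = c \<and> b = d"
        by (simp add: pip_simps zz zf fp pip_commute[of "f1 s" z])
    qed simp
    have F: "focal_surface \<gamma> f1 f2 \<alpha> n (s, \<theta>) = cosh \<theta> *\<^sub>R z + sinh \<theta> *\<^sub>R f1 s"
      by (simp add: focal_surface_def z_def)
    have "focal_surface \<gamma> f1 f2 \<alpha> n (s, \<theta>) \<in>
          {AdS_evolute I \<gamma> f1 f2 \<alpha> l n s, - AdS_evolute I \<gamma> f1 f2 \<alpha> l n s} \<longleftrightarrow>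
        (\<exists>\<epsilon>\<in>{1, -1}. cosh \<theta> = \<epsilon> * (p / r) \<and> sinh \<theta> = - \<epsilon> * (q / r))"
      using comb[of "cosh \<theta>" "sinh \<theta>" "p / r" "- (q / r)"]
        comb[of "cosh \<theta>" "sinh \<theta>" "- (p / r)" "q / r"]
      unfolding F E by simp
    then show "singular_point I (focal_surface \<gamma> f1 f2 \<alpha> n) (s, \<theta>) \<longleftrightarrow>
        evolute_disc I \<alpha> l n s < 0 \<and>
        focal_surface \<gamma> f1 f2 \<alpha> n (s, \<theta>) \<in>
          {AdS_evolute I \<gamma> f1 f2 \<alpha> l n s, - AdS_evolute I \<gamma> f1 f2 \<alpha> l n s}"
      using cosh_sinh_proportional_iff[of q p \<theta>] assms(6)[OF s]
      unfolding sing disc r_def by simp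
    show "\<exists>\<theta>. singular_point I (focal_surface \<gamma> f1 f2 \<alpha> n) (s, \<theta>)"
      if "evolute_disc I \<alpha> l n s < 0"
    proof
      have "q\<^sup>2 < p\<^sup>2" using that by (simp add: disc)
      then have lt: "\<bar>q\<bar> < \<bar>p\<bar>" by (simp add: not_le[symmetric] abs_le_square_iff)
      then have p: "p \<noteq> 0" by auto
      \<comment> \<open>Divided by \<open>p * cosh \<theta>\<close>, the singularity equation reads
        \<open>tanh \<theta> = - q / p\<close>, solvable because a negative discriminant means
        \<open>\<bar>q\<bar> < \<bar>p\<bar>\<close>.\<close>
      let ?\<theta> = "artanh (- q / p)"
      have "\<bar>- q / p\<bar> < 1" using lt by (simp add: field_simps)
      then have "tanh ?\<theta> = - q / p" by (rule tanh_artanh_real)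
      moreover have "cosh ?\<theta> \<noteq> 0" using cosh_real_pos[of ?\<theta>] by linarith
      ultimately show "singular_point I (focal_surface \<gamma> f1 f2 \<alpha> n) (s, ?\<theta>)"
        using p by (simp add: sing tanh_def field_simps)
    qed
  qed
  \<comment> \<open>For the angle from \<open>ex\<close>, membership in the evolute pair follows by
    applying \<open>main\<close> to it.\<close>
  show ?thesis
    using main ex by blast
qed

end
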